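(* Let $\mathcal{C}$ be an $[n,k,d]_q$ MDS code of distance $d\ge 2$, and let $\mathcal{V}$ be one of its cosets. Then, for $w\ge d-1$, the weight distribution of $\mathcal{V}$ is determined by the values $B_v(\mathcal{V})$, $0\le v\le d-2$, as follows: $$B_w(\mathcal{V})=A_w(\mathcal{C})-\Omega_w^{(0)}(n,d)+\sum_{v=0}^{d-2}\Omega_w^{(v)}(n,d)\,B_v(\mathcal{V}),\qquad w=d-1,d,\ldots,n,$$ where $$\Omega_w^{(v)}(n,d)=(-1)^{w-d}\binom{n-v}{w-v}\binom{w-1-v}{d-2-v}.$$
   Context: $\mathbb{F}_q$ is the finite field with $q$ elements. An $[n,k,d]_q$ code is a $k$-dimensional $\mathbb{F}_q$-linear subspace of $\mathbb{F}_q^n$ with minimum Hamming distance $d$; it is MDS if $d=n-k+1$. A coset of $\mathcal{C}$ is a set $\mathcal{V}=\{\mathbf{c}+\mathbf{v}:\mathbf{c}\in\mathcal{C}\}$ with $\mathbf{v}\in\mathbb{F}_q^n$ fixed. $A_w(\mathcal{C})$ is the number of codewords of Hamming weight $w$ in $\mathcal{C}$ (so $A_w(\mathcal{C})=0$ for $0<w<d$), and $B_w(\mathcal{V})$ is the number of vectors of Hamming weight $w$ in $\mathcal{V}$. *)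

theory Defs
  imports "HOL-Analysis.Analysis"
begin

definition hamming_dist :: "'a ^ 'n \<Rightarrow> 'a ^ 'n \<Rightarrow> nat" where
  "hamming_dist x y = card {i. x $ i \<noteq> y $ i}"

definition hamming_weight :: "'a::zero ^ 'n \<Rightarrow> nat" where
  "hamming_weight x = card {i. x $ i \<noteq> 0}"

text \<open>
  A relation rather than a function, since a set with at most one element has no minimum
  distance. In particular, a code with a minimum distance has dimension at least 1.
\<close>
definition has_min_distance :: "('a ^ 'n) set \<Rightarrow> nat \<Rightarrow> bool" where
  "has_min_distance C d \<longleftrightarrow>
     (\<exists>x\<in>C. \<exists>y\<in>C. x \<noteq> y \<and> hamming_dist x y = d) \<and>
     (\<forall>x\<in>C. \<forall>y\<in>C. x \<noteq> y \<longrightarrow> d \<le> hamming_dist x y)"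

text \<open>
  \<open>C\<close> is an $[n,k,d]_q$ code. The field with \<open>q\<close> elements is the type \<open>'a\<close>, and its \<open>n\<close>-th power
  is \<open>'a ^ 'n\<close> for an index type \<open>'n\<close> with \<open>n\<close> elements.
\<close>
definition linear_code ::
  "nat \<Rightarrow> nat \<Rightarrow> nat \<Rightarrow> nat \<Rightarrow> ('a::{field,finite} ^ 'n) set \<Rightarrow> bool" where
  "linear_code q n k d C \<longleftrightarrow>
     CARD('a) = q \<and> CARD('n) = n \<and>
     vec.subspace C \<and> vec.dim C = k \<and> has_min_distance C d"

text \<open>The subtraction is exact, because \<open>k \<le> n\<close> for every code.\<close>
definition MDS_code ::
  "nat \<Rightarrow> nat \<Rightarrow> nat \<Rightarrow> nat \<Rightarrow> ('a::{field,finite} ^ 'n) set \<Rightarrow> bool" where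
  "MDS_code q n k d C \<longleftrightarrow> linear_code q n k d C \<and> d = n - k + 1"

definition is_coset :: "('a::plus ^ 'n) set \<Rightarrow> ('a ^ 'n) set \<Rightarrow> bool" where
  "is_coset C V \<longleftrightarrow> (\<exists>v. V = {c + v | c. c \<in> C})"

text \<open>Both $A_w$ (for the code itself) and $B_w$ (for its cosets).\<close>
definition weight_count :: "('a::zero ^ 'n) set \<Rightarrow> nat \<Rightarrow> nat" where
  "weight_count S w = card {x \<in> S. hamming_weight x = w}"

text \<open>
  $\Omega_w^{(v)}(n,d)$. It is used only for \<open>2 \<le> d\<close>, \<open>v \<le> d - 2\<close> and \<open>d - 1 \<le> w \<le> n\<close>, where all
  the natural-number subtractions are exact. The exponent of the sign is \<open>-1\<close> for \<open>w = d - 1\<close>,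
  hence the integer power.
\<close>
definition Omega :: "nat \<Rightarrow> nat \<Rightarrow> nat \<Rightarrow> nat \<Rightarrow> real" where
  "Omega n d v w =
     (-1) powi (int w - int d) *
     real ((n - v) choose (w - v)) * real ((w - 1 - v) choose (d - 2 - v))"

end

theory Submission imports Defs begin

text \<open>
  For a set \<open>T\<close> of at least \<open>d - 1\<close> coordinates, the vectors supported in \<open>T\<close> together with \<open>C\<close>
  span the whole space, because \<open>C\<close> is MDS. So \<open>V\<close> contains a vector supported in \<open>T\<close>, and
  translation by it shows that \<open>V\<close> and \<open>C\<close> contain equally many such vectors. Summing over all
  \<open>T\<close> of size \<open>t\<close>, the differences $D_v = B_v(V) - A_v(C)$ satisfy
  $\sum_{v \le t} \binom{n-v}{t-v} D_v = 0$ for \<open>d - 1 \<le> t \<le> n\<close>. This triangular system is solved by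
  $D_w = \sum_{v \le d-2} \Omega_w^{(v)} D_v$, and $D_v = B_v(V) - [v = 0]$ for \<open>v \<le> d - 2\<close>.
\<close>

section \<open>Alternating binomial sums and inversion of the triangular system\<close>

text \<open>Induction on \<open>m\<close>: Pascal's rule turns the sum for \<open>Suc m\<close> into
  the sum for \<open>m\<close> plus an extra sum, which vanishes.\<close>

lemma sum_alternating_choose_product:
  fixes m r :: nat
  assumes "r \<le> m"
  shows "(\<Sum>j = Suc r..Suc m. (-1) ^ (j - Suc r) * real (Suc m choose j) * real ((j - 1) choose r)) = 1"
  using assms
proof (induction m rule: dec_induct)
  case base
  then show ?case by simp
next
  case (step m)
  \<comment> \<open>The extra sum from Pascal's rule: once \<open>Suc m choose r\<close> is factored
    out, the alternating sum of the binomial row \<open>Suc m - r\<close> remains, and it is 0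
    because this index is positive.\<close>
  have "(\<Sum>j = Suc r..Suc (Suc m).
          (-1) ^ (j - Suc r) * real (Suc m choose (j - 1)) * real ((j - 1) choose r))
      = (\<Sum>i = r..Suc m. (-1) ^ (i - r) * real (Suc m choose i) * real (i choose r))"
    by (subst sum.shift_bounds_cl_Suc_ivl) simp
  also have "\<dots> = (\<Sum>i = r..Suc m. (-1) ^ (i - r) * real (Suc m choose r) * real ((Suc m - r) choose (i - r)))"
  proof (rule sum.cong[OF refl])
    fix i assume "i \<in> {r..Suc m}"
    then have "(Suc m choose i) * (i choose r) = (Suc m choose r) * ((Suc m - r) choose (i - r))"
      by (intro choose_mult) auto
    then show "(-1) ^ (i - r) * real (Suc m choose i) * real (i choose r)
        = (-1) ^ (i - r) * real (Suc m choose r) * real ((Suc m - r) choose (i - r))"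
      by (metis mult.assoc of_nat_mult)
  qed
  also have "\<dots> = real (Suc m choose r) * (\<Sum>i = r..Suc m. (-1) ^ (i - r) * real ((Suc m - r) choose (i - r)))"
    by (simp only: sum_distrib_left mult_ac)
  also have "(\<Sum>i = r..Suc m. (-1) ^ (i - r) * real ((Suc m - r) choose (i - r)))
      = (\<Sum>i\<le>Suc m - r. (-1) ^ i * real ((Suc m - r) choose i))"
    by (rule sum.reindex_bij_witness[where i = "\<lambda>i. i + r" and j = "\<lambda>i. i - r"])
       (use step.hyps in auto)
  also have "\<dots> = 0"
    using step.hyps by (intro choose_alternating_sum) simp
  finally have extra: "(\<Sum>j = Suc r..Suc (Suc m).
      (-1) ^ (j - Suc r) * real (Suc m choose (j - 1)) * real ((j - 1) choose r)) = 0"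
    by simp
  have "(\<Sum>j = Suc r..Suc (Suc m). (-1) ^ (j - Suc r) * real (Suc (Suc m) choose j) * real ((j - 1) choose r))
     = (\<Sum>j = Suc r..Suc (Suc m). (-1) ^ (j - Suc r) * real (Suc m choose j) * real ((j - 1) choose r)
         + (-1) ^ (j - Suc r) * real (Suc m choose (j - 1)) * real ((j - 1) choose r))"
  proof (rule sum.cong[OF refl])
    fix j assume "j \<in> {Suc r..Suc (Suc m)}"
    then obtain i where "j = Suc i" by (cases j) auto
    then show "(-1) ^ (j - Suc r) * real (Suc (Suc m) choose j) * real ((j - 1) choose r)
       = (-1) ^ (j - Suc r) * real (Suc m choose j) * real ((j - 1) choose r)
         + (-1) ^ (j - Suc r) * real (Suc m choose (j - 1)) * real ((j - 1) choose r)"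
      by (simp add: choose_reduce_nat[of "Suc (Suc m)" "Suc i"] algebra_simps)
  qed
  \<comment> \<open>The summand at \<open>j = Suc (Suc m)\<close> drops out, since
    \<open>Suc m choose j\<close> is 0 there.\<close>
  also have "\<dots> = (\<Sum>j = Suc r..Suc m. (-1) ^ (j - Suc r) * real (Suc m choose j) * real ((j - 1) choose r))"
    unfolding sum.distrib extra using step.hyps by (simp add: binomial_eq_0)
  finally show ?case using step.IH by simp
qed

text \<open>Factoring out \<open>(n - v) choose (t - v)\<close> and shifting to
  \<open>j = w - v\<close> leaves \<open>sum_alternating_choose_product\<close>. In terms of the
  triangular system, \<open>Omega n d v\<close> continues the initial values 1 at \<open>v\<close>
  and 0 elsewhere up to \<open>d - 2\<close> to a solution.\<close>

lemma sum_Omega_choose: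
  fixes n d v t :: nat
  assumes "2 \<le> d" "v \<le> d - 2" "d - 1 \<le> t" "t \<le> n"
  shows "(\<Sum>w = d - 1..t. Omega n d v w * real ((n - w) choose (t - w))) = - real ((n - v) choose (t - v))"
proof -
  define r m where "r = d - 2 - v" and "m = t - 1 - v"
  have rm: "r \<le> m" "d - 1 = Suc r + v" "t = Suc m + v"
    using assms by (auto simp: r_def m_def)
  have "(\<Sum>w = d - 1..t. Omega n d v w * real ((n - w) choose (t - w)))
     = (\<Sum>j = Suc r..Suc m. - real ((n - v) choose (t - v)) *
          ((-1) ^ (j - Suc r) * real (Suc m choose j) * real ((j - 1) choose r)))"
  proof (rule sum.reindex_bij_witness[where i = "\<lambda>j. j + v" and j = "\<lambda>w. w - v"])
    fix w assume w: "w \<in> {d - 1..t}"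
    have "((n - v) choose (t - v)) * ((t - v) choose (w - v))
        = ((n - v) choose (w - v)) * ((n - v - (w - v)) choose (t - v - (w - v)))"
      using w assms by (intro choose_mult) auto
    moreover have "n - v - (w - v) = n - w" "t - v - (w - v) = t - w"
      using w assms by auto
    ultimately have "((n - v) choose (w - v)) * ((n - w) choose (t - w))
        = ((n - v) choose (t - v)) * (Suc m choose (w - v))"
      using rm by simp
    then have ch: "real ((n - v) choose (w - v)) * real ((n - w) choose (t - w))
        = real ((n - v) choose (t - v)) * real (Suc m choose (w - v))"
      by (metis of_nat_mult)
    \<comment> \<open>Here \<open>w - v - Suc r\<close> is \<open>w - (d - 1)\<close>, one more than
      the exponent in \<open>Omega\<close>; this produces the minus sign.\<close>
    have "int w - int d = int (w - v - Suc r) - 1"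
      using w assms rm by (auto simp: r_def)
    then have "(-1::real) powi (int w - int d) = - ((-1) ^ (w - v - Suc r))"
      by (simp add: power_int_diff)
    moreover have "w - 1 - v = w - v - 1" "d - 2 - v = r"
      by (auto simp: r_def)
    ultimately show "- real ((n - v) choose (t - v)) *
          ((-1) ^ (w - v - Suc r) * real (Suc m choose (w - v)) * real ((w - v - 1) choose r))
        = Omega n d v w * real ((n - w) choose (t - w))"
      unfolding Omega_def using ch by (simp add: algebra_simps)
  qed (use assms rm in auto)
  also have "\<dots> = - real ((n - v) choose (t - v))"
    unfolding sum_distrib_left[symmetric] sum_alternating_choose_product[OF rm(1)] by simp
  finally show ?thesis .
qed

text \<open>Forward substitution: the equation at \<open>t = w\<close> has coefficient 1 at
  \<open>D w\<close>. Strong induction rewrites the values from \<open>d - 1\<close> to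
  \<open>w - 1\<close> through the initial ones, and \<open>sum_Omega_choose\<close> evaluates the
  resulting coefficients.\<close>

lemma Omega_expansion:
  fixes D :: "nat \<Rightarrow> real"
  assumes "2 \<le> d"
    and moments: "\<And>t. d - 1 \<le> t \<Longrightarrow> t \<le> n \<Longrightarrow> (\<Sum>v\<le>t. D v * real ((n - v) choose (t - v))) = 0"
    and "d - 1 \<le> w" "w \<le> n"
  shows "D w = (\<Sum>v = 0..d - 2. Omega n d v w * D v)"
  using assms(3,4)
proof (induction w rule: less_induct)
  case (less w)
  let ?c = "\<lambda>v. real ((n - v) choose (w - v))"
  have split: "{..w} = {0..d - 2} \<union> {d - 1..<w} \<union> {w}"
    using less.prems \<open>2 \<le> d\<close> by auto
  have "0 = (\<Sum>v = 0..d - 2. D v * ?c v) + (\<Sum>u = d - 1..<w. D u * ?c u) + D w"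
    using moments[OF less.prems] less.prems \<open>2 \<le> d\<close> unfolding split
    by (subst (asm) sum.union_disjoint, simp, simp, force)
       (subst (asm) sum.union_disjoint, auto)
  moreover have "(\<Sum>u = d - 1..<w. D u * ?c u)
      = (\<Sum>u = d - 1..<w. \<Sum>v = 0..d - 2. D v * (Omega n d v u * ?c u))"
    using less by (intro sum.cong[OF refl]) (simp add: sum_distrib_left sum_distrib_right mult_ac)
  moreover have "\<dots> = (\<Sum>v = 0..d - 2. D v * (\<Sum>u = d - 1..<w. Omega n d v u * ?c u))"
    by (subst sum.swap) (simp add: sum_distrib_left)
  \<comment> \<open>This is \<open>sum_Omega_choose\<close> at \<open>t = w\<close> with the summand
    \<open>u = w\<close> split off; its binomial factor is
    \<open>(n - w) choose 0 = 1\<close>.\<close>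
  moreover have "(\<Sum>u = d - 1..<w. Omega n d v u * ?c u) = - ?c v - Omega n d v w"
    if "v \<le> d - 2" for v
  proof -
    have "{d - 1..w} = insert w {d - 1..<w}" using less.prems by auto
    then show ?thesis
      using sum_Omega_choose[OF \<open>2 \<le> d\<close> that less.prems] by simp
  qed
  ultimately have "0 = (\<Sum>v = 0..d - 2. D v * ?c v)
      + (\<Sum>v = 0..d - 2. D v * (- ?c v - Omega n d v w)) + D w"
    by simp
  then show ?case
    by (simp add: algebra_simps sum_subtractf sum_negf)
qed

section \<open>Double counting of vectors and sets containing their supports\<close>

lemma card_supersets_of_card:
  assumes "finite U" "S \<subseteq> U" "card S \<le> t"
  shows "card {T. S \<subseteq> T \<and> T \<subseteq> U \<and> card T = t} = (card U - card S) choose (t - card S)"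
proof -
  have fS: "finite S" using assms finite_subset by blast
  have "bij_betw (\<lambda>T. T - S) {T. S \<subseteq> T \<and> T \<subseteq> U \<and> card T = t} {R. R \<subseteq> U - S \<and> card R = t - card S}"
  proof (rule bij_betw_byWitness[where f' = "\<lambda>R. R \<union> S"])
    show "(\<lambda>R. R \<union> S) ` {R. R \<subseteq> U - S \<and> card R = t - card S} \<subseteq> {T. S \<subseteq> T \<and> T \<subseteq> U \<and> card T = t}"
    proof clarify
      fix R assume R: "R \<subseteq> U - S" "card R = t - card S"
      then have "card (R \<union> S) = card R + card S"
        using fS assms(1) by (intro card_Un_disjoint) (auto intro: finite_subset)
      then show "S \<subseteq> R \<union> S \<and> R \<union> S \<subseteq> U \<and> card (R \<union> S) = t"
        using R assms by auto
    qed
  qed (use fS in \<open>auto simp: card_Diff_subset\<close>)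
  then show ?thesis
    using assms fS by (simp add: bij_betw_same_card n_subsets card_Diff_subset)
qed

text \<open>Both sides count the pairs of a vector \<open>x\<close> in \<open>V\<close> and a
  \<open>t\<close>-set \<open>T\<close> containing its support; on the left they are sorted by the
  weight of \<open>x\<close>.\<close>

lemma sum_weight_count_choose:
  fixes V :: "('a::{zero,finite} ^ 'n) set"
  shows "(\<Sum>v\<le>t. weight_count V v * ((CARD('n) - v) choose (t - v)))
       = (\<Sum>T | card T = t. card {x \<in> V. {i. x $ i \<noteq> 0} \<subseteq> T})"
proof -
  have fin: "finite V" by (rule finite_subset[OF subset_UNIV]) simp
  have "(\<Sum>T | card T = t. card {x \<in> V. {i. x $ i \<noteq> 0} \<subseteq> T})
      = (\<Sum>x\<in>V. card {T. card T = t \<and> {i. x $ i \<noteq> 0} \<subseteq> T})"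
    using fin by (intro sum_multicount_gen) auto
  also have "\<dots> = (\<Sum>x\<in>{x \<in> V. hamming_weight x \<le> t}. (CARD('n) - hamming_weight x) choose (t - hamming_weight x))"
  proof (rule sum.mono_neutral_cong_right[OF fin])
    \<comment> \<open>A support of size above \<open>t\<close> fits into no \<open>t\<close>-set.
      Such vectors must be removed first, as the truncated \<open>t - hamming_weight x\<close> would
      make the binomial 1.\<close>
    show "\<forall>x\<in>V - {x \<in> V. hamming_weight x \<le> t}. card {T. card T = t \<and> {i. x $ i \<noteq> 0} \<subseteq> T} = 0"
      by (auto simp: hamming_weight_def intro: card_mono)
  next
    fix x assume "x \<in> {x \<in> V. hamming_weight x \<le> t}"
    then show "card {T. card T = t \<and> {i. x $ i \<noteq> 0} \<subseteq> T} = (CARD('n) - hamming_weight x) choose (t - hamming_weight x)"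
      using card_supersets_of_card[of UNIV "{i. x $ i \<noteq> 0}" t]
      by (simp add: hamming_weight_def conj_commute)
  qed auto
  also have "\<dots> = (\<Sum>v\<le>t. \<Sum>x\<in>{x \<in> V. hamming_weight x = v}. (CARD('n) - v) choose (t - v))"
    using fin by (subst sum.group[symmetric, where g = hamming_weight and T = "{..t}"])
      (auto intro!: sum.cong arg_cong[where f = card])
  also have "\<dots> = (\<Sum>v\<le>t. weight_count V v * ((CARD('n) - v) choose (t - v)))"
    by (simp add: weight_count_def)
  finally show ?thesis by simp
qed

section \<open>Supports of vectors in an MDS code and its cosets\<close>

lemma hamming_dist_zero [simp]: "hamming_dist x 0 = hamming_weight x"
  by (simp add: hamming_dist_def hamming_weight_def)

lemma hamming_weight_eq_0_iff [simp]: "hamming_weight x = 0 \<longleftrightarrow> x = 0"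
  by (simp add: hamming_weight_def vec_eq_iff)

lemma min_distance_le_hamming_weight:
  assumes "linear_code q n k d C" "x \<in> C" "x \<noteq> 0"
  shows "d \<le> hamming_weight x"
proof -
  have "0 \<in> C" using assms(1) by (simp add: linear_code_def vec.subspace_0)
  then have "d \<le> hamming_dist x 0"
    using assms unfolding linear_code_def has_min_distance_def by blast
  then show ?thesis by simp
qed

text \<open>The vectors supported in \<open>d - 1\<close> fixed coordinates form a complement of
  \<open>C\<close>: they meet \<open>C\<close> only in 0, and the two dimensions add up to
  \<open>n\<close>.\<close>

lemma MDS_code_complement:
  fixes C :: "('a::{field,finite} ^ 'n) set"
  assumes C: "MDS_code q n k d C" and T: "d - 1 \<le> card T"
  obtains c where "c \<in> C" "{i. (v - c) $ i \<noteq> 0} \<subseteq> T"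
proof -
  have lin: "linear_code q n k d C" and d: "d = n - k + 1" and sub: "vec.subspace C"
    and dim: "vec.dim C = k" and n: "CARD('n) = n"
    using C by (auto simp: MDS_code_def linear_code_def)
  have "k \<le> n" using dim_subset_UNIV_cart_gen[of C] dim n by simp
  \<comment> \<open>Cutting \<open>T\<close> down to exactly \<open>d - 1\<close> coordinates keeps
    all weights in \<open>U\<close> below the minimum distance.\<close>
  obtain S where S: "S \<subseteq> T" "card S = d - 1"
    using T obtain_subset_with_card_n by metis
  define U where "U = {x :: 'a ^ 'n. \<forall>i. i \<notin> S \<longrightarrow> x $ i = 0}"
  have subU: "vec.subspace U" by (auto simp: U_def vec.subspace_def)
  have dimU: "vec.dim U = d - 1"
    unfolding U_def S(2)[symmetric] by (rule dim_substandard_cart)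
  have "C \<inter> U = {0}"
  proof (intro equalityI subsetI)
    fix x assume x: "x \<in> C \<inter> U"
    have "hamming_weight x \<le> d - 1"
      unfolding hamming_weight_def S(2)[symmetric]
      using x by (intro card_mono) (auto simp: U_def)
    then show "x \<in> {0}"
      using min_distance_le_hamming_weight[OF lin, of x] x d by fastforce
  qed (use sub subU vec.subspace_0 in auto)
  \<comment> \<open>As \<open>k \<le> n\<close>, the dimensions add up to
    \<open>k + (d - 1) = k + (n - k) = n\<close>.\<close>
  then have "vec.dim {x + y |x y. x \<in> C \<and> y \<in> U} = n"
    using vec.dim_sums_Int[OF sub subU] dim dimU d \<open>k \<le> n\<close> by simp
  then have "{x + y |x y. x \<in> C \<and> y \<in> U} = UNIV"
    using vec.subspace_dim_equal[OF vec.subspace_sums[OF sub subU] vec.subspace_UNIV] n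
    by (simp add: card_cart_basis)
  then obtain c u where "v = c + u" "c \<in> C" "u \<in> U" by blast
  then show thesis using S by (intro that[of c]) (auto simp: U_def)
qed

text \<open>\<open>MDS_code_complement\<close> gives a representative \<open>v - c\<close> of the
  coset supported in \<open>T\<close>. Subtracting it maps \<open>V\<close> onto \<open>C\<close>
  and changes no coordinate outside \<open>T\<close>.\<close>

lemma card_coset_support_subset:
  fixes C V :: "('a::{field,finite} ^ 'n) set"
  assumes C: "MDS_code q n k d C" and V: "is_coset C V" and T: "d - 1 \<le> card T"
  shows "card {x \<in> V. {i. x $ i \<noteq> 0} \<subseteq> T} = card {x \<in> C. {i. x $ i \<noteq> 0} \<subseteq> T}"
proof -
  have sub: "vec.subspace C" using C by (simp add: MDS_code_def linear_code_def)
  obtain v where v: "V = {c + v | c. c \<in> C}" using V by (auto simp: is_coset_def)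
  obtain c where c: "c \<in> C" "{i. (v - c) $ i \<noteq> 0} \<subseteq> T"
    using MDS_code_complement[OF C T] .
  let ?u = "v - c"
  have u0: "?u $ i = 0" if "i \<notin> T" for i using c that by blast
  have V': "x \<in> V \<longleftrightarrow> x - ?u \<in> C" for x
  proof
    assume "x \<in> V"
    then obtain e where "x = e + v" "e \<in> C" using v by auto
    then show "x - ?u \<in> C" using vec.subspace_add[OF sub _ c(1), of e] by simp
  next
    assume "x - ?u \<in> C"
    then have "x - v \<in> C" using vec.subspace_diff[OF sub _ c(1), of "x - ?u"] by simp
    then show "x \<in> V" unfolding v by (intro CollectI exI[of _ "x - v"]) simp
  qed
  have "bij_betw (\<lambda>x. x - ?u) {x \<in> V. {i. x $ i \<noteq> 0} \<subseteq> T} {x \<in> C. {i. x $ i \<noteq> 0} \<subseteq> T}"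
    by (rule bij_betw_byWitness[where f' = "\<lambda>x. x + ?u"]) (use u0 V' in \<open>auto simp: subset_iff\<close>)
  then show ?thesis by (rule bij_betw_same_card)
qed

theorem theorem1p1:
  fixes C V :: "('a::{field,finite} ^ 'n) set"
    and q n k d :: nat
  assumes "MDS_code q n k d C"
    and "d \<ge> 2"
    and "is_coset C V"
  shows "\<forall>w\<in>{d - 1..n}.
    real (weight_count V w) =
      real (weight_count C w) - Omega n d 0 w
      + (\<Sum>v = 0..d - 2. Omega n d v w * real (weight_count V v))"
proof
  fix w assume w: "w \<in> {d - 1..n}"
  have lin: "linear_code q n k d C" and n: "CARD('n) = n" and sub: "vec.subspace C"
    using assms(1) by (auto simp: MDS_code_def linear_code_def)
  let ?D = "\<lambda>v. real (weight_count V v) - real (weight_count C v)"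
  \<comment> \<open>Weights up to \<open>d - 2\<close> are below the minimum distance, so only the
    zero codeword is counted.\<close>
  have low: "weight_count C v = (if v = 0 then 1 else 0)" if "v \<le> d - 2" for v
  proof -
    have "x = 0" if "x \<in> C" "hamming_weight x = v" for x
      using min_distance_le_hamming_weight[OF lin, of x] that \<open>v \<le> d - 2\<close> \<open>d \<ge> 2\<close> by force
    then have "{x \<in> C. hamming_weight x = v} = (if v = 0 then {0} else {})"
      using vec.subspace_0[OF sub] by (fastforce split: if_splits)
    then show ?thesis by (simp add: weight_count_def)
  qed
  \<comment> \<open>Every \<open>t\<close>-set is large enough for
    \<open>card_coset_support_subset\<close>, so the double counts for \<open>V\<close> and
    \<open>C\<close> agree set by set.\<close>
  have moments: "(\<Sum>v\<le>t. ?D v * real ((n - v) choose (t - v))) = 0" if "d - 1 \<le> t" for t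
  proof -
    have "(\<Sum>v\<le>t. weight_count V v * ((n - v) choose (t - v)))
        = (\<Sum>v\<le>t. weight_count C v * ((n - v) choose (t - v)))"
      unfolding n[symmetric] sum_weight_count_choose
      using card_coset_support_subset[OF assms(1,3)] that by (intro sum.cong) auto
    then have "real (\<Sum>v\<le>t. weight_count V v * ((n - v) choose (t - v)))
        = real (\<Sum>v\<le>t. weight_count C v * ((n - v) choose (t - v)))"
      by simp
    then show ?thesis by (simp add: left_diff_distrib sum_subtractf)
  qed
  have "?D w = (\<Sum>v = 0..d - 2. Omega n d v w * ?D v)"
    using w by (intro Omega_expansion[OF \<open>d \<ge> 2\<close> moments]) auto
  \<comment> \<open>By \<open>low\<close>, \<open>C\<close> contributes only at
    \<open>v = 0\<close>, which is the source of the term \<open>- Omega n d 0 w\<close>.\<close>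
  also have "\<dots> = (\<Sum>v = 0..d - 2. Omega n d v w * real (weight_count V v)
      - (if v = 0 then Omega n d v w else 0))"
    by (rule sum.cong) (auto simp: low algebra_simps)
  also have "\<dots> = (\<Sum>v = 0..d - 2. Omega n d v w * real (weight_count V v)) - Omega n d 0 w"
    by (simp add: sum_subtractf)
  finally show "real (weight_count V w) = real (weight_count C w) - Omega n d 0 w
      + (\<Sum>v = 0..d - 2. Omega n d v w * real (weight_count V v))"
    by simp
qed

end
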